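(* Assume $\operatorname{rank} W_0 = n+m$. Consider the indirect problem (I) and the direct problem (D) defined in the context. In (I) the variables $(\hat A,\hat B)$ are uniquely determined and can be eliminated. In (D) the variable $G$ is uniquely determined (by $K$) and can be eliminated. In either case the elimination gives rise to the identical problem $$\text{(C)}\qquad \min_{P\succeq I,\,K}\ \operatorname{trace}(QP+K^\top RKP)\quad\text{subject to}\quad \Big(X_1W_0^\dagger\begin{bmatrix}K\\ I\end{bmatrix}\Big)P\Big(X_1W_0^\dagger\begin{bmatrix}K\\ I\end{bmatrix}\Big)^\top-P+I\preceq 0 .$$ That is: (i) there is exactly one pair $(\hat A,\hat B)$ satisfying the inner least-squares constraint of (I), and with this pair, $(P,K)$ is feasible for (I) if and only if it is feasible for (C); (ii) for each $K$ there is exactly one $G$ satisfying both $\begin{bmatrix}K\\ I\end{bmatrix}=W_0G$ and $(I-W_0^\dagger W_0)G=0$, and with this $G$, $(P,K,G)$ is feasible for (D) if and only if $(P,K)$ is feasible for (C). The objective functions of (I), (D) and (C) are the same function of $(P,K)$.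
   Context: Data: $u(k)\in\mathbb R^m$, $x(k)\in\mathbb R^n$ are generated by $x(k+1)=Ax(k)+Bu(k)+d(k)$ with unknown real matrices $A\in\mathbb R^{n\times n}$, $B\in\mathbb R^{n\times m}$, $(A,B)$ stabilizable, and an arbitrary unknown disturbance $d(k)\in\mathbb R^n$. Set $U_0=[u(0)\ \cdots\ u(T-1)]\in\mathbb R^{m\times T}$, $X_0=[x(0)\ \cdots\ x(T-1)]\in\mathbb R^{n\times T}$, $X_1=[x(1)\ \cdots\ x(T)]\in\mathbb R^{n\times T}$, $D_0=[d(0)\ \cdots\ d(T-1)]\in\mathbb R^{n\times T}$, so that $X_1-D_0=[B\ \ A]W_0$, where $W_0=\begin{bmatrix}U_0\\ X_0\end{bmatrix}\in\mathbb R^{(n+m)\times T}$. When $\operatorname{rank}W_0=n+m$, $W_0^\dagger=W_0^\top(W_0W_0^\top)^{-1}$ denotes the (Moore–Penrose) right inverse. $Q\in\mathbb R^{n\times n}$ and $R\in\mathbb R^{m\times m}$ are symmetric positive definite. $P\in\mathbb R^{n\times n}$ is symmetric, $K\in\mathbb R^{m\times n}$, $G\in\mathbb R^{T\times n}$; $\succeq,\preceq$ is the semidefinite order; $\|\cdot\|_F$ is the Frobenius norm. Problem (I) (indirect certainty-equivalence LQR): minimize $\operatorname{trace}(QP+K^\top RKP)$ over $P\succeq I$ and $K$, subject to $(\hat A+\hat BK)P(\hat A+\hat BK)^\top-P+I\preceq0$ and $[\hat B\ \ \hat A]=\arg\min_{B,A}\|X_1-[B\ \ A]W_0\|_F$.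 Problem (D) (direct LQR): minimize $\operatorname{trace}(QP+K^\top RKP)$ over $P\succeq I$, $K$ and $G$, subject to $X_1GPG^\top X_1^\top-P+I\preceq0$, $\begin{bmatrix}K\\ I\end{bmatrix}=W_0G$, and $(I-W_0^\dagger W_0)G=0$. *)

theory Defs
  imports "HOL-Analysis.Analysis"
begin

text \<open>
  Dimensions are types: \<open>'n\<close> for the state, \<open>'m\<close> for the input, \<open>'t\<close> for the samples, so that
  \<open>T = CARD('t)\<close>; block indices live in \<open>'m + 'n\<close> (input block first). As \<open>'t\<close> carries no order,
  a bijection \<open>\<tau>\<close> from \<open>'t\<close> onto \<open>{0..<T}\<close> says which time each column records.
\<close>

definition data_matrix :: "('t::finite \<Rightarrow> nat) \<Rightarrow> (nat \<Rightarrow> real^'k) \<Rightarrow> real^'t^'k::finite"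
  where "data_matrix \<tau> s = (\<chi> i j. s (\<tau> j) $ i)"

definition vstack :: "real^'c^'a \<Rightarrow> real^'c^'b \<Rightarrow> real^'c^('a::finite + 'b::finite)"
  where "vstack M N = (\<chi> i. case i of Inl a \<Rightarrow> M $ a | Inr b \<Rightarrow> N $ b)"

definition hstack :: "real^'a^'r \<Rightarrow> real^'b^'r \<Rightarrow> real^('a::finite + 'b::finite)^'r"
  where "hstack M N = (\<chi> i j. case j of Inl a \<Rightarrow> M $ i $ a | Inr b \<Rightarrow> N $ i $ b)"

definition frobenius_norm :: "real^'c^'r \<Rightarrow> real"
  where "frobenius_norm M = sqrt (\<Sum>i\<in>UNIV. \<Sum>j\<in>UNIV. (M $ i $ j)\<^sup>2)"

definition right_pinv :: "real^'c^'r \<Rightarrow> real^'r^'c"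
  where "right_pinv W = transpose W ** matrix_inv (W ** transpose W)"

definition pos_semidef :: "real^'k^'k \<Rightarrow> bool"
  where "pos_semidef M \<longleftrightarrow> transpose M = M \<and> (\<forall>v. 0 \<le> v \<bullet> (M *v v))"

definition pos_def :: "real^'k^'k \<Rightarrow> bool"
  where "pos_def M \<longleftrightarrow> transpose M = M \<and> (\<forall>v. v \<noteq> 0 \<longrightarrow> 0 < v \<bullet> (M *v v))"

text \<open>Since \<^const>\<open>pos_semidef\<close> includes symmetry, \<open>mat 1 \<preceq> P\<close> forces \<open>P\<close> to be symmetric.\<close>

definition loewner_le :: "real^'k^'k \<Rightarrow> real^'k^'k \<Rightarrow> bool"  (infix "\<preceq>" 50)
  where "M \<preceq> N \<longleftrightarrow> pos_semidef (N - M)"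

text \<open>Discrete-time stability: every complex eigenvalue lies in the open unit disc.\<close>

definition schur_stable :: "real^'k^'k \<Rightarrow> bool"
  where "schur_stable M \<longleftrightarrow>
    (\<forall>(z::complex) v. v \<noteq> 0 \<and> (\<chi> i j. complex_of_real (M $ i $ j)) *v v = z *s v \<longrightarrow> cmod z < 1)"

definition stabilizable :: "real^'n^'n \<Rightarrow> real^'m^'n \<Rightarrow> bool"
  where "stabilizable A B \<longleftrightarrow> (\<exists>K :: real^'n^'m. schur_stable (A + B ** K))"

text \<open>A minimization problem in a variable of type \<open>'v\<close>.\<close>

record 'v problem =
  objective :: "'v \<Rightarrow> real"
  feasible :: "'v set"

definition lqr_cost :: "real^'n^'n \<Rightarrow> real^'m^'m \<Rightarrow> real^'n^'n \<Rightarrow> real^'n^'m \<Rightarrow> real"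
  where "lqr_cost Q R P K = trace (Q ** P + transpose K ** R ** K ** P)"

definition least_squares_models ::
    "real^'t^'n \<Rightarrow> real^'t^('m + 'n) \<Rightarrow> ((real^'n^'n) \<times> (real^'m^'n)) set"
  where "least_squares_models X1 W0 =
    {(A, B). is_arg_min (\<lambda>(A', B'). frobenius_norm (X1 - hstack B' A' ** W0)) (\<lambda>_. True) (A, B)}"

definition indirect_problem ::
    "real^'n^'n \<Rightarrow> real^'m^'m \<Rightarrow> real^'t^'n \<Rightarrow> real^'t^('m + 'n) \<Rightarrow>
      ((real^'n^'n) \<times> (real^'n^'m) \<times> (real^'n^'n) \<times> (real^'m^'n)) problem"
  where "indirect_problem Q R X1 W0 =
    \<lparr> objective = (\<lambda>(P, K, A, B). lqr_cost Q R P K),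
      feasible = {(P, K, A, B). mat 1 \<preceq> P \<and>
        (A + B ** K) ** P ** transpose (A + B ** K) - P + mat 1 \<preceq> 0 \<and>
        (A, B) \<in> least_squares_models X1 W0} \<rparr>"

definition direct_parameters :: "real^'t^('m + 'n) \<Rightarrow> real^'n^'m \<Rightarrow> (real^'n^'t) set"
  where "direct_parameters W0 K =
    {G. vstack K (mat 1) = W0 ** G \<and> (mat 1 - right_pinv W0 ** W0) ** G = 0}"

definition direct_problem ::
    "real^'n^'n \<Rightarrow> real^'m^'m \<Rightarrow> real^'t^'n \<Rightarrow> real^'t^('m + 'n) \<Rightarrow>
      ((real^'n^'n) \<times> (real^'n^'m) \<times> (real^'n^'t)) problem"
  where "direct_problem Q R X1 W0 =
    \<lparr> objective = (\<lambda>(P, K, G). lqr_cost Q R P K),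
      feasible = {(P, K, G). mat 1 \<preceq> P \<and>
        X1 ** G ** P ** transpose G ** transpose X1 - P + mat 1 \<preceq> 0 \<and>
        G \<in> direct_parameters W0 K} \<rparr>"

definition common_problem ::
    "real^'n^'n \<Rightarrow> real^'m^'m \<Rightarrow> real^'t^'n \<Rightarrow> real^'t^('m + 'n) \<Rightarrow>
      ((real^'n^'n) \<times> (real^'n^'m)) problem"
  where "common_problem Q R X1 W0 =
    \<lparr> objective = (\<lambda>(P, K). lqr_cost Q R P K),
      feasible = {(P, K). mat 1 \<preceq> P \<and>
        (X1 ** right_pinv W0 ** vstack K (mat 1)) ** P **
          transpose (X1 ** right_pinv W0 ** vstack K (mat 1)) - P + mat 1 \<preceq> 0} \<rparr>"

end

theory Submission
  imports Defs
begin

text \<open>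
  Since \<open>W\<close> has full row rank, \<open>W W\<^sup>\<top>\<close> is invertible and \<open>W\<^sup>\<dagger>\<close> is a right inverse of \<open>W\<close>.
  The residual of \<open>H = X W\<^sup>\<dagger>\<close> annihilates \<open>W\<^sup>\<top>\<close>, so by Pythagoras
  \<open>\<parallel>X - H' W\<parallel>\<^sup>2 = \<parallel>X - H W\<parallel>\<^sup>2 + \<parallel>(H - H') W\<parallel>\<^sup>2\<close>, and \<open>H\<close> is the unique least-squares model.
  Likewise \<open>W G = V\<close> and \<open>G = W\<^sup>\<dagger> W G\<close> hold together exactly when \<open>G = W\<^sup>\<dagger> V\<close>.  Both problems
  therefore have the closed-loop matrix \<open>X W\<^sup>\<dagger> [K; I]\<close>.
\<close>

text \<open>Full row rank gives \<open>W\<close> a right inverse, so \<open>transpose W\<close> has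
  a left inverse and is injective. As v \<bullet> (W W^T v) is the squared norm of W^T v, the Gram
  matrix has trivial kernel.\<close>

lemma invertible_gram:
  fixes W :: "real^'c^'r"
  assumes "rank W = CARD('r)"
  shows "invertible (W ** transpose W)"
proof -
  obtain B where "W ** B = mat 1"
    using assms full_rank_surjective matrix_right_invertible_surjective by blast
  then have BW: "transpose B ** transpose W = mat 1"
    by (metis matrix_transpose_mul transpose_mat)
  have "v = 0" if "(W ** transpose W) *v v = 0" for v
  proof -
    have "(transpose W *v v) \<bullet> (transpose W *v v) = v \<bullet> ((W ** transpose W) *v v)"
      by (metis dot_lmul_matrix matrix_vector_mul_assoc transpose_matrix_vector)
    then have "transpose W *v v = 0"
      using that by simp
    then show "v = 0"
      by (metis BW matrix_vector_mul_assoc matrix_vector_mul_lid matrix_vector_mult_0_right)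
  qed
  then show ?thesis
    by (metis invertible_left_inverse matrix_left_invertible_ker)
qed

lemma matrix_inv_inverse:
  fixes M :: "'a::semiring_1^'c^'r"
  assumes "invertible M"
  shows "M ** matrix_inv M = mat 1" and "matrix_inv M ** M = mat 1"
  using someI_ex[OF assms[unfolded invertible_def]] by (simp_all add: matrix_inv_def)

lemma matrix_diff_rdistrib:
  fixes A B :: "'a::ring_1^'k^'r" and C :: "'a^'c^'k"
  shows "(A - B) ** C = A ** C - B ** C"
  by (simp add: matrix_matrix_mult_def vec_eq_iff left_diff_distrib sum_subtractf)

lemma right_pinv_right_inverse:
  fixes W :: "real^'c^'r"
  assumes "rank W = CARD('r)"
  shows "W ** right_pinv W = mat 1"
  using matrix_inv_inverse(1)[OF invertible_gram[OF assms]]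
  by (simp add: right_pinv_def matrix_mul_assoc)

text \<open>\<open>right_pinv W ** W\<close> is the orthogonal projector onto the row space of
  \<open>W\<close>, hence fixes the columns of \<open>transpose W\<close>.\<close>

lemma right_pinv_mult_transpose:
  fixes W :: "real^'c^'r"
  assumes "rank W = CARD('r)"
  shows "right_pinv W ** W ** transpose W = transpose W"
  using matrix_inv_inverse(2)[OF invertible_gram[OF assms]]
  by (simp add: right_pinv_def flip: matrix_mul_assoc)

lemma frobenius_norm_eq_norm: "frobenius_norm M = norm M"
  by (simp add: frobenius_norm_def norm_eq_sqrt_inner inner_vec_def power2_eq_square)

text \<open>For the Frobenius inner product, right multiplication by \<open>transpose W\<close> is
  the adjoint of right multiplication by \<open>W\<close>; the proof swaps two finite sums in each
  row.\<close>

lemma inner_matrix_mult_right: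
  fixes M :: "real^'c^'r" and H :: "real^'k^'r" and W :: "real^'c^'k"
  shows "M \<bullet> (H ** W) = (M ** transpose W) \<bullet> H"
proof -
  have "M $ i \<bullet> (H ** W) $ i = (M ** transpose W) $ i \<bullet> H $ i" for i
  proof -
    have "M $ i \<bullet> (H ** W) $ i = (\<Sum>j\<in>UNIV. \<Sum>k\<in>UNIV. M $ i $ j * (H $ i $ k * W $ k $ j))"
      by (simp add: inner_vec_def matrix_matrix_mult_def sum_distrib_left)
    also have "\<dots> = (\<Sum>k\<in>UNIV. \<Sum>j\<in>UNIV. M $ i $ j * (H $ i $ k * W $ k $ j))"
      by (rule sum.swap)
    also have "\<dots> = (M ** transpose W) $ i \<bullet> H $ i"
      by (simp add: inner_vec_def matrix_matrix_mult_def transpose_def sum_distrib_left mult_ac)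
    finally show ?thesis .
  qed
  then show ?thesis
    by (simp add: inner_vec_def)
qed

lemma residual_pythagoras:
  fixes X :: "real^'c^'r" and W :: "real^'c^'k"
  assumes "rank W = CARD('k)"
  shows "(norm (X - H ** W))\<^sup>2
    = (norm (X - X ** right_pinv W ** W))\<^sup>2 + (norm ((X ** right_pinv W - H) ** W))\<^sup>2"
proof -
  let ?E = "X - X ** right_pinv W ** W" and ?F = "(X ** right_pinv W - H) ** W"
  have "X ** right_pinv W ** W ** transpose W = X ** transpose W"
    by (metis right_pinv_mult_transpose[OF assms] matrix_mul_assoc)
  \<comment> \<open>These are the normal equations; by the adjoint identity they make
    \<open>?E\<close> orthogonal to every matrix of the form \<open>H' ** W\<close>.\<close>
  then have "?E ** transpose W = 0"
    by (simp add: matrix_diff_rdistrib)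
  then have "orthogonal ?E ?F"
    by (simp add: orthogonal_def inner_matrix_mult_right)
  then have "(norm (?E + ?F))\<^sup>2 = (norm ?E)\<^sup>2 + (norm ?F)\<^sup>2"
    by (rule norm_add_Pythagorean)
  moreover have "?E + ?F = X - H ** W"
    by (simp add: matrix_diff_rdistrib)
  ultimately show ?thesis by simp
qed

lemma is_arg_min_residual_iff:
  fixes X :: "real^'c^'r" and W :: "real^'c^'k"
  assumes "rank W = CARD('k)"
  shows "is_arg_min (\<lambda>H. norm (X - H ** W)) (\<lambda>_. True) H \<longleftrightarrow> H = X ** right_pinv W"
proof -
  let ?H = "X ** right_pinv W"
  have le: "norm (X - ?H ** W) \<le> norm (X - H' ** W)" for H'
    by (rule power2_le_imp_le) (simp_all add: residual_pythagoras[OF assms, of X H'])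
  have unique: "H = ?H" if "norm (X - H ** W) \<le> norm (X - ?H ** W)"
  proof -
    have "(norm (X - H ** W))\<^sup>2 \<le> (norm (X - ?H ** W))\<^sup>2"
      using that by (simp add: power_mono)
    then have "(?H - H) ** W = 0"
      by (simp add: residual_pythagoras[OF assms, of X H])
    \<comment> \<open>Full row rank yields uniqueness here: the right inverse cancels
      \<open>W\<close>.\<close>
    then have "(?H - H) ** W ** right_pinv W = 0"
      by simp
    then show ?thesis
      by (simp add: right_pinv_right_inverse[OF assms] flip: matrix_mul_assoc)
  qed
  show ?thesis
    using le unique by (auto simp: is_arg_min_linorder)
qed

text \<open>Surjectivity of \<open>hstack\<close>: minimizing over pairs of blocks is the same as
  minimizing over all matrices \<open>H\<close>.\<close>

lemma hstack_cases:
  obtains M N where "H = hstack M N"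
proof
  show "H = hstack (\<chi> i a. H $ i $ Inl a) (\<chi> i b. H $ i $ Inr b)"
    by (simp add: hstack_def vec_eq_iff split: sum.split)
qed

text \<open>Injectivity of \<open>hstack\<close> carries uniqueness of the optimal \<open>H\<close>
  over to the pair of its blocks.\<close>

lemma hstack_eq_iff: "hstack M N = hstack M' N' \<longleftrightarrow> M = M' \<and> N = N'"
  by (force simp: hstack_def vec_eq_iff split: sum.splits)

lemma sum_UNIV_sum:
  fixes f :: "'a::finite + 'b::finite \<Rightarrow> 'c::comm_monoid_add"
  shows "sum f UNIV = (\<Sum>a\<in>UNIV. f (Inl a)) + (\<Sum>b\<in>UNIV. f (Inr b))"
  unfolding UNIV_sum by (subst sum.union_disjoint) (auto simp: sum.reindex)

lemma hstack_mult_vstack: "hstack M N ** vstack K L = M ** K + N ** L"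
  by (simp add: hstack_def vstack_def vec_eq_iff matrix_matrix_mult_def sum_UNIV_sum)

lemma least_squares_models_iff:
  fixes X1 :: "real^'t^'n" and W0 :: "real^'t^('m::finite + 'n::finite)"
  assumes "rank W0 = CARD('m + 'n)"
  shows "(A, B) \<in> least_squares_models X1 W0 \<longleftrightarrow> hstack B A = X1 ** right_pinv W0"
proof -
  have "(A, B) \<in> least_squares_models X1 W0 \<longleftrightarrow>
      (\<forall>A' B'. norm (X1 - hstack B A ** W0) \<le> norm (X1 - hstack B' A' ** W0))"
    by (auto simp: least_squares_models_def is_arg_min_linorder frobenius_norm_eq_norm)
  also have "\<dots> \<longleftrightarrow> (\<forall>H. norm (X1 - hstack B A ** W0) \<le> norm (X1 - H ** W0))"
    by (metis hstack_cases)
  also have "\<dots> \<longleftrightarrow> is_arg_min (\<lambda>H. norm (X1 - H ** W0)) (\<lambda>_. True) (hstack B A)"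
    by (auto simp: is_arg_min_linorder)
  finally show ?thesis
    by (simp add: is_arg_min_residual_iff[OF assms])
qed

lemma ex1_least_squares_model:
  fixes X1 :: "real^'t^'n" and W0 :: "real^'t^('m::finite + 'n::finite)"
  assumes "rank W0 = CARD('m + 'n)"
  shows "\<exists>!M. M \<in> least_squares_models X1 W0"
proof -
  obtain B A where BA: "X1 ** right_pinv W0 = hstack B A"
    by (rule hstack_cases)
  show ?thesis
  proof (rule ex1I[of _ "(A, B)"])
    show "(A, B) \<in> least_squares_models X1 W0"
      by (simp add: least_squares_models_iff[OF assms] BA)
    show "M = (A, B)" if "M \<in> least_squares_models X1 W0" for M
      using that by (cases M) (simp add: least_squares_models_iff[OF assms] BA hstack_eq_iff)
  qed
qed

lemma direct_parameters_eq:
  fixes W0 :: "real^'t^('m::finite + 'n::finite)"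
  assumes "rank W0 = CARD('m + 'n)"
  shows "direct_parameters W0 K = {right_pinv W0 ** vstack K (mat 1)}"
proof -
  have "vstack K (mat 1) = W0 ** G \<and> G = right_pinv W0 ** W0 ** G \<longleftrightarrow>
      G = right_pinv W0 ** vstack K (mat 1)" for G
    \<comment> \<open>Forwards, the first equation is substituted into the second; backwards,
      \<open>W0 ** right_pinv W0 = mat 1\<close> yields both.\<close>
    by (metis matrix_mul_assoc matrix_mul_lid right_pinv_right_inverse[OF assms])
  then show ?thesis
    by (auto simp: direct_parameters_def matrix_diff_rdistrib)
qed

lemma feasible_indirect_iff:
  fixes W0 :: "real^'t^('m::finite + 'n::finite)"
  assumes "rank W0 = CARD('m + 'n)" and "(A, B) \<in> least_squares_models X1 W0"
  shows "(P, K, A, B) \<in> feasible (indirect_problem Q R X1 W0) \<longleftrightarrow>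
    (P, K) \<in> feasible (common_problem Q R X1 W0)"
proof -
  \<comment> \<open>The least-squares matrix is \<open>hstack B A\<close>, input block first, and
    its block product with \<open>vstack K (mat 1)\<close> is the closed loop.\<close>
  have "X1 ** right_pinv W0 ** vstack K (mat 1) = A + B ** K"
    using assms(2)[unfolded least_squares_models_iff[OF assms(1)], symmetric]
    by (simp add: hstack_mult_vstack add.commute)
  then show ?thesis
    using assms(2) by (simp add: indirect_problem_def common_problem_def)
qed

text \<open>With the only admissible \<open>G\<close> inserted, \<open>X1 ** G\<close> is the
  closed-loop matrix of the common problem, and the transposes regroup into its transpose.\<close>

lemma feasible_direct_iff:
  fixes W0 :: "real^'t^('m::finite + 'n::finite)"
  assumes "rank W0 = CARD('m + 'n)" and "G \<in> direct_parameters W0 K"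
  shows "(P, K, G) \<in> feasible (direct_problem Q R X1 W0) \<longleftrightarrow>
    (P, K) \<in> feasible (common_problem Q R X1 W0)"
  using assms
  by (simp add: direct_parameters_eq direct_problem_def common_problem_def
      matrix_transpose_mul matrix_mul_assoc)

theorem mainTheorem1:
  fixes A :: "real^'n^'n" and B :: "real^'m^'n"
    and Q :: "real^'n^'n" and R :: "real^'m^'m"
    and u :: "nat \<Rightarrow> real^'m" and x d :: "nat \<Rightarrow> real^'n"
    and \<tau> :: "'t::finite \<Rightarrow> nat"
    and U0 :: "real^'t^'m" and X0 X1 :: "real^'t^'n" and W0 :: "real^'t^('m + 'n)"
  assumes "stabilizable A B"
    and "\<And>k. k < CARD('t) \<Longrightarrow> x (Suc k) = A *v x k + B *v u k + d k"
    and "bij_betw \<tau> UNIV {0..<CARD('t)}"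
    and "U0 = data_matrix \<tau> u"
    and "X0 = data_matrix \<tau> x"
    and "X1 = data_matrix \<tau> (\<lambda>k. x (Suc k))"
    and "W0 = vstack U0 X0"
    and "pos_def Q" and "pos_def R"
    and "rank W0 = CARD('n) + CARD('m)"
  shows
    "(\<exists>!M. M \<in> least_squares_models X1 W0) \<and>
     (\<forall>Ah Bh. (Ah, Bh) \<in> least_squares_models X1 W0 \<longrightarrow>
       (\<forall>P K. (P, K, Ah, Bh) \<in> feasible (indirect_problem Q R X1 W0) \<longleftrightarrow>
              (P, K) \<in> feasible (common_problem Q R X1 W0))) \<and>
     (\<forall>K. (\<exists>!G. G \<in> direct_parameters W0 K) \<and>
       (\<forall>G. G \<in> direct_parameters W0 K \<longrightarrow>
         (\<forall>P. (P, K, G) \<in> feasible (direct_problem Q R X1 W0) \<longleftrightarrow>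
              (P, K) \<in> feasible (common_problem Q R X1 W0)))) \<and>
     (\<forall>P K Ah Bh. objective (indirect_problem Q R X1 W0) (P, K, Ah, Bh) =
                  objective (common_problem Q R X1 W0) (P, K)) \<and>
     (\<forall>P K G. objective (direct_problem Q R X1 W0) (P, K, G) =
              objective (common_problem Q R X1 W0) (P, K))"
proof -
  have rank: "rank W0 = CARD('m + 'n)"
    using assms(10) by simp
  show ?thesis
    \<comment> \<open>Existence and uniqueness of \<open>G\<close> follow from the singleton form of
      \<open>direct_parameters\<close>; all three objectives unfold to
      \<open>lqr_cost Q R P K\<close>.\<close>
    using ex1_least_squares_model[OF rank] feasible_indirect_iff[OF rank]
      feasible_direct_iff[OF rank]
    by (simp add: direct_parameters_eq[OF rank]
        indirect_problem_def direct_problem_def common_problem_def)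
qed

end
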